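(* Let $n\ge 2$, $k\ge 2$ and $m\geq 1$ be integers. If $S$ is an $\mathcal{OS}_k(n)$ of period $m$, then its edge-graph $E_n(S)$ is an antisymmetric Eulerian subgraph of $B_{k}(n-1)$ containing $m$ edges. Moreover, if $T$ is an antisymmetric Eulerian subgraph of $B_{k}(n-1)$ with $m$ edges, then there exists an $\mathcal{OS}_k(n)$ $S$ of period $m$ such that $E_n(S)=T$.
   Context: Sequences. For an infinite periodic sequence $S=(s_i)$ with elements in $\mathbb{Z}_k$, write $\mathbf{s}_n(i)=(s_i,s_{i+1},\ldots,s_{i+n-1})$. For a tuple $\mathbf{u}=(u_0,\ldots,u_{r-1})$ its reverse is $\mathbf{u}^R=(u_{r-1},\ldots,u_0)$. $S$, of period $m$, is a $k$-ary $n$-window sequence if $\mathbf{s}_n(i)=\mathbf{s}_n(j)$ implies $i\equiv j \pmod m$. A $k$-ary $n$-window sequence $S$ is an orientable sequence of order $n$, an $\mathcal{OS}_k(n)$, if $\mathbf{s}_n(i)\neq \mathbf{s}_n(j)^R$ for all $i,j$ (including $i=j$). Graphs. For $r\geq 1$, the de Bruijn digraph $B_k(r)$ has vertex set $\mathbb{Z}_k^r$, and $(\mathbf{x},\mathbf{y})$ is a (directed) edge iff $y_i=x_{i+1}$ for $0\le i<r-1$; this edge is identified with the $(r+1)$-tuple $(x_0,\ldots,x_{r-1},y_{r-1})$ (distinct $(r+1)$-tuples give distinct edges). So edges of $B_k(n-1)$ are $k$-ary $n$-tuples. An Eulerian digraph is a connected digraph in which every vertex has in-degree equal to out-degree. A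 subgraph $T$ of $B_k(r)$ is antisymmetric if whenever $(\mathbf{x},\mathbf{y})$ is an edge of $T$, $(\mathbf{y}^R,\mathbf{x}^R)$ is not an edge of $T$ (equivalently, if the tuple $\mathbf{a}$ labels an edge of $T$, then $\mathbf{a}^R$ does not). The edge-graph $E_n(S)$ of a $k$-ary $n$-window sequence $S$ of period $m$ is the subgraph of $B_k(n-1)$ with edge set $\{\mathbf{s}_n(i): 0\le i\le m-1\}$ and whose vertices are those having in-degree at least one. *)

theory Defs
  imports "Graph_Theory.Graph_Theory" "HOL-Number_Theory.Cong"
begin

section \<open>Periodic sequences\<close>

text \<open>
  The elements of \<open>\<int>\<^sub>k\<close> are represented by the naturals below \<open>k\<close>, and tuples over \<open>\<int>\<^sub>k\<close> by lists.
\<close>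

definition tuples :: "nat \<Rightarrow> nat \<Rightarrow> nat list set" where
  "tuples k r = {xs. length xs = r \<and> set xs \<subseteq> {..<k}}"

definition periodic_seq :: "nat \<Rightarrow> nat \<Rightarrow> (nat \<Rightarrow> nat) \<Rightarrow> bool" where
  "periodic_seq k m S \<longleftrightarrow> 0 < m \<and> (\<forall>i. S i < k) \<and> (\<forall>i. S (i + m) = S i)"

definition window :: "(nat \<Rightarrow> nat) \<Rightarrow> nat \<Rightarrow> nat \<Rightarrow> nat list" where
  "window S n i = map (\<lambda>j. S (i + j)) [0..<n]"

text \<open>
  The window condition forces \<open>m\<close> to be the least period: if \<open>d > 0\<close> is a period then the windows
  at \<open>0\<close> and \<open>d\<close> agree, so \<open>m\<close> divides \<open>d\<close>.
\<close>

definition window_seq :: "nat \<Rightarrow> nat \<Rightarrow> nat \<Rightarrow> (nat \<Rightarrow> nat) \<Rightarrow> bool" where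
  "window_seq k n m S \<longleftrightarrow>
     periodic_seq k m S \<and> (\<forall>i j. window S n i = window S n j \<longrightarrow> [i = j] (mod m))"

definition orientable_seq :: "nat \<Rightarrow> nat \<Rightarrow> nat \<Rightarrow> (nat \<Rightarrow> nat) \<Rightarrow> bool" where
  "orientable_seq k n m S \<longleftrightarrow>
     window_seq k n m S \<and> (\<forall>i j. window S n i \<noteq> rev (window S n j))"

section \<open>De Bruijn digraphs\<close>

text \<open>
  An edge from \<open>x\<close> to \<open>y\<close> is represented by the tuple \<open>x\<^sub>0, \<dots>, x\<^bsub>r-1\<^esub>, y\<^bsub>r-1\<^esub>\<close>;
  removing its last entry gives back \<open>x\<close>, removing its first entry gives back \<open>y\<close>.
\<close>

definition debruijn :: "nat \<Rightarrow> nat \<Rightarrow> (nat list, nat list) pre_digraph" where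
  "debruijn k r = \<lparr>verts = tuples k r, arcs = tuples k (Suc r), tail = butlast, head = tl\<rparr>"

lemma debruijn_dominates_iff:
  assumes "1 \<le> r" "x \<in> tuples k r" "y \<in> tuples k r"
  shows "x \<rightarrow>\<^bsub>debruijn k r\<^esub> y \<longleftrightarrow> (\<forall>i < r - 1. y ! i = x ! Suc i)"
proof
  assume "x \<rightarrow>\<^bsub>debruijn k r\<^esub> y"
  then obtain a where a: "a \<in> tuples k (Suc r)" "x = butlast a" "y = tl a"
    by (auto simp: arcs_ends_def arc_to_ends_def debruijn_def)
  then show "\<forall>i < r - 1. y ! i = x ! Suc i"
    by (auto simp: tuples_def nth_tl nth_butlast)
next
  assume R: "\<forall>i < r - 1. y ! i = x ! Suc i"
  have len: "length x = r" "length y = r" and sub: "set x \<subseteq> {..<k}" "set y \<subseteq> {..<k}"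
    using assms by (auto simp: tuples_def)
  define a where "a = x @ [last y]"
  have "y \<noteq> []" using len assms by auto
  then have "last y < k" using sub(2) last_in_set[of y] by blast
  then have "a \<in> tuples k (Suc r)"
    using len sub(1) by (simp add: a_def tuples_def)
  moreover have "tl a = y"
  proof (rule nth_equalityI)
    show "length (tl a) = length y" using len by (simp add: a_def)
    fix i assume "i < length (tl a)"
    then have "i < r" using len by (simp add: a_def)
    show "tl a ! i = y ! i"
    proof (cases "i < r - 1")
      case True
      then have "Suc i < r" by simp
      then show ?thesis using True R len by (simp add: a_def nth_tl nth_append)
    next
      case False
      then have "i = r - 1" using \<open>i < r\<close> by simp
      then show ?thesis using len assms(1) \<open>y \<noteq> []\<close>
        by (simp add: a_def nth_tl nth_append last_conv_nth)
    qed
  qed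
  moreover have "butlast a = x" by (simp add: a_def)
  ultimately show "x \<rightarrow>\<^bsub>debruijn k r\<^esub> y"
    by (force simp: arcs_ends_def arc_to_ends_def debruijn_def)
qed

definition antisymmetric_graph :: "(nat list, nat list) pre_digraph \<Rightarrow> bool" where
  "antisymmetric_graph T \<longleftrightarrow> (\<forall>x y. x \<rightarrow>\<^bsub>T\<^esub> y \<longrightarrow> \<not> (rev y \<rightarrow>\<^bsub>T\<^esub> rev x))"

text \<open>
  Here \<^const>\<open>connected\<close> means that the underlying undirected graph is connected
  (and has at least one vertex).
\<close>

definition eulerian :: "('a, 'b) pre_digraph \<Rightarrow> bool" where
  "eulerian G \<longleftrightarrow> connected G \<and> (\<forall>v \<in> verts G. in_degree G v = out_degree G v)"

definition edge_graph ::
  "nat \<Rightarrow> nat \<Rightarrow> nat \<Rightarrow> (nat \<Rightarrow> nat) \<Rightarrow> (nat list, nat list) pre_digraph" where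
  "edge_graph k n m S =
     (let H = (debruijn k (n - 1))\<lparr>arcs := window S n ` {0..m - 1}\<rparr>
      in H\<lparr>verts := {v \<in> verts H. 1 \<le> in_degree H v}\<rparr>)"

end

theory Submission
  imports Defs
begin

text \<open>
  Reading a sequence \<open>S\<close> of period \<open>m\<close> through a window of length \<open>n\<close> is the same as walking
  around a closed walk of length \<open>m\<close> in the de Bruijn digraph: the window at \<open>i\<close> is an edge that
  leads from the \<open>(n - 1)\<close>-window at \<open>i\<close> to the \<open>(n - 1)\<close>-window at \<open>i + 1\<close>. The window property
  says that this closed walk repeats no edge, so it is an Euler circuit of the edge graph. Hence the
  edge graph is Eulerian and has \<open>m\<close> edges (\<open>window_graph_euler_trail\<close>).

  Conversely, Euler's theorem supplies a closed trail through all edges of an Eulerian digraph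
  \<open>T\<close>. The first entries of these edges, repeated periodically, form a sequence whose windows
  are the edges themselves, because consecutive edges overlap in \<open>n - 1\<close> entries
  (\<open>window_hd_of_overlapping\<close>). The circuit has no repeated edge, so this is a window sequence, and its
  edge graph is \<open>T\<close>.

  In both directions orientability and antisymmetry correspond. An edge of the de Bruijn digraph is
  determined by its two endpoints, and reversing a tuple exchanges and reverses these endpoints;
  so a graph is antisymmetric iff no edge tuple has its reverse among the edge tuples
  (\<open>antisymmetric_graph_iff_rev\<close>).
\<close>

section \<open>Antisymmetry in terms of edge tuples\<close>

lemma list_eq_if_butlast_tl_eq:
  assumes "butlast xs = butlast ys" "tl xs = tl ys"
    and "2 \<le> length xs" "2 \<le> length ys"
  shows "xs = ys"
proof -
  have split: "zs = butlast zs @ [last (tl zs)]" if "2 \<le> length zs" for zs :: "'a list"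
    using that by (cases zs) (auto split: if_splits)
  show ?thesis
    using split[OF assms(3)] split[OF assms(4)] assms(1,2) by metis
qed

text \<open>
  The edge \<open>rev a\<close> leads from \<open>rev (tl a)\<close> to \<open>rev (butlast a)\<close>, and it is the only tuple of length
  \<open>n\<close> that does. For \<open>n = 1\<close> uniqueness fails: all tuples are loops at the empty list.
\<close>

lemma antisymmetric_graph_iff_rev:
  assumes "tail T = butlast" "head T = tl"
    and len: "\<And>a. a \<in> arcs T \<Longrightarrow> length a = n" and "2 \<le> n"
  shows "antisymmetric_graph T \<longleftrightarrow> (\<forall>a \<in> arcs T. rev a \<notin> arcs T)"
proof -
  have dom: "x \<rightarrow>\<^bsub>T\<^esub> y \<longleftrightarrow> (\<exists>a \<in> arcs T. butlast a = x \<and> tl a = y)" for x y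
    using assms(1,2) by (auto simp: arcs_ends_def arc_to_ends_def)
  have rev_dom: "(rev (tl a) \<rightarrow>\<^bsub>T\<^esub> rev (butlast a)) \<longleftrightarrow> rev a \<in> arcs T" if a: "a \<in> arcs T" for a
  proof -
    have ends: "butlast (rev a) = rev (tl a)" "tl (rev a) = rev (butlast a)"
      by (metis butlast_rev rev_rev_ident)+
    have "b = rev a" if "b \<in> arcs T" "butlast b = rev (tl a)" "tl b = rev (butlast a)" for b
    proof (rule list_eq_if_butlast_tl_eq)
      show "butlast b = butlast (rev a)" "tl b = tl (rev a)"
        unfolding ends by (fact that)+
      show "2 \<le> length b" "2 \<le> length (rev a)"
        using len[OF a] len[OF that(1)] \<open>2 \<le> n\<close> by simp_all
    qed
    with ends show ?thesis
      unfolding dom by blast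
  qed
  have all_arcs: "(\<forall>x y. x \<rightarrow>\<^bsub>T\<^esub> y \<longrightarrow> P x y) \<longleftrightarrow> (\<forall>a \<in> arcs T. P (butlast a) (tl a))" for P
    unfolding dom by auto
  have "antisymmetric_graph T \<longleftrightarrow> (\<forall>a \<in> arcs T. \<not> (rev (tl a) \<rightarrow>\<^bsub>T\<^esub> rev (butlast a)))"
    unfolding antisymmetric_graph_def by (rule all_arcs)
  also have "\<dots> \<longleftrightarrow> (\<forall>a \<in> arcs T. rev a \<notin> arcs T)"
    by (intro ball_cong refl) (simp only: rev_dom)
  finally show ?thesis .
qed

section \<open>Edge graphs as graphs of windows\<close>

lemma length_window [simp]: "length (window S n i) = n"
  by (simp add: window_def)

lemma nth_window [simp]: "j < n \<Longrightarrow> window S n i ! j = S (i + j)"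
  by (simp add: window_def)

lemma butlast_window [simp]: "butlast (window S (Suc r) i) = window S r i"
  by (simp add: window_def)

lemma tl_window [simp]: "tl (window S (Suc r) i) = window S r (Suc i)"
  by (rule nth_equalityI) (simp_all add: nth_tl)

lemma window_seq_imp_periodic: "window_seq k n m S \<Longrightarrow> periodic_seq k m S"
  by (simp add: window_seq_def)

lemma window_in_tuples:
  assumes "periodic_seq k m S"
  shows "window S n i \<in> tuples k n"
  using assms by (auto simp: tuples_def window_def periodic_seq_def)

lemma window_mod:
  assumes "periodic_seq k m S"
  shows "window S n (i mod m) = window S n i"
proof -
  have step: "S (j + m * q) = S j" for j q
  proof (induction q)
    case (Suc q)
    have "S (j + m * Suc q) = S ((j + m * q) + m)"
      by (simp add: algebra_simps)
    with Suc assms show ?case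
      by (simp add: periodic_seq_def)
  qed simp
  have "S (i mod m + j) = S (i + j)" for j
    using step[of "i mod m + j" "i div m"] by (simp add: algebra_simps)
  then show ?thesis
    by (simp add: window_def)
qed

lemma inj_on_window:
  assumes "window_seq k n m S"
  shows "inj_on (window S n) {0..<m}"
proof (rule inj_onI)
  fix i j assume "i \<in> {0..<m}" "j \<in> {0..<m}" and "window S n i = window S n j"
  moreover from this have "[i = j] (mod m)"
    using assms by (simp add: window_seq_def)
  ultimately show "i = j"
    by (simp add: cong_def)
qed

lemma range_window:
  assumes "periodic_seq k m S"
  shows "range (window S n) = window S n ` {0..<m}"
proof -
  have "0 < m"
    using assms by (simp add: periodic_seq_def)
  then have "window S n i \<in> window S n ` {0..<m}" for i
    by (subst window_mod[OF assms, symmetric]) simp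
  then show ?thesis
    by blast
qed

text \<open>
  The edge graph in a form that mentions neither the period nor the in-degrees.
\<close>

definition window_graph :: "(nat \<Rightarrow> nat) \<Rightarrow> nat \<Rightarrow> (nat list, nat list) pre_digraph" where
  "window_graph S r =
     \<lparr>verts = range (window S r), arcs = range (window S (Suc r)), tail = butlast, head = tl\<rparr>"

lemma window_graph_simps [simp]:
  "verts (window_graph S r) = range (window S r)"
  "arcs (window_graph S r) = range (window S (Suc r))"
  "tail (window_graph S r) = butlast"
  "head (window_graph S r) = tl"
  by (simp_all add: window_graph_def)

text \<open>
  The windows of length \<open>r\<close> are exactly the heads of edges: the one at \<open>i\<close> is the head of the edge
  at \<open>i - 1\<close>, where for \<open>i = 0\<close> the period gives a predecessor.
\<close>

lemma edge_graph_eq_window_graph: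
  assumes per: "periodic_seq k m S"
  shows "edge_graph k (Suc r) m S = window_graph S r"
proof -
  have "0 < m"
    using per by (simp add: periodic_seq_def)
  then have "{0..m - 1} = {0..<m}"
    by auto
  then have arcs: "window S (Suc r) ` {0..m - 1} = range (window S (Suc r))"
    using range_window[OF per] by simp
  define H where "H = (debruijn k r)\<lparr>arcs := range (window S (Suc r))\<rparr>"
  have "1 \<le> in_degree H v \<longleftrightarrow> v \<in> range (window S r)" for v
  proof -
    have in_arcs: "in_arcs H v = {e \<in> range (window S (Suc r)). tl e = v}"
      by (simp add: in_arcs_def H_def debruijn_def)
    have "finite (in_arcs H v)"
      unfolding in_arcs using range_window[OF per, of "Suc r"] by simp
    then have "1 \<le> in_degree H v \<longleftrightarrow> in_arcs H v \<noteq> {}"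
      by (simp add: in_degree_def Suc_le_eq card_gt_0_iff)
    also have "\<dots> \<longleftrightarrow> v \<in> range (\<lambda>i. window S r (Suc i))"
      unfolding in_arcs by auto
    also have "range (\<lambda>i. window S r (Suc i)) = range (window S r)"
    proof -
      \<comment> \<open>\<open>i + m - 1\<close> stands in for \<open>i - 1\<close>, which truncates at \<open>i = 0\<close>.\<close>
      have "window S r i = window S r (Suc (i + m - 1))" for i
        using window_mod[OF per, of r i] window_mod[OF per, of r "i + m"] \<open>0 < m\<close> by simp
      then show ?thesis
        by blast
    qed
    finally show ?thesis .
  qed
  moreover have "range (window S r) \<subseteq> tuples k r"
    using window_in_tuples[OF per] by blast
  ultimately have "{v \<in> verts H. 1 \<le> in_degree H v} = range (window S r)"
    by (auto simp: H_def debruijn_def)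
  then show ?thesis
    unfolding edge_graph_def window_graph_def Let_def arcs diff_Suc_1 H_def[symmetric]
    by (simp add: H_def debruijn_def)
qed

lemma wf_digraph_debruijn: "wf_digraph (debruijn k r)"
proof
  fix e assume "e \<in> arcs (debruijn k r)"
  then have e: "length e = Suc r" "set e \<subseteq> {..<k}"
    by (simp_all add: debruijn_def tuples_def)
  then show "tail (debruijn k r) e \<in> verts (debruijn k r)"
    by (auto simp: debruijn_def tuples_def dest: in_set_butlastD)
  from e show "head (debruijn k r) e \<in> verts (debruijn k r)"
    by (auto simp: debruijn_def tuples_def dest: list.set_sel(2)[rotated])
qed

lemma fin_digraph_window_graph:
  assumes "periodic_seq k m S"
  shows "fin_digraph (window_graph S r)"
proof
  show "finite (verts (window_graph S r))" "finite (arcs (window_graph S r))"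
    using range_window[OF assms] by simp_all
qed auto

lemma subgraph_window_graph_debruijn:
  assumes "periodic_seq k m S"
  shows "subgraph (window_graph S r) (debruijn k r)"
proof (rule subgraphI)
  show "wf_digraph (window_graph S r)"
    using fin_digraph_window_graph[OF assms] by (rule fin_digraph.axioms)
qed (use window_in_tuples[OF assms] in
      \<open>auto simp: debruijn_def compatible_def wf_digraph_debruijn[unfolded debruijn_def]\<close>)

section \<open>Window sequences as Euler circuits\<close>

lemma cas_windows:
  "pre_digraph.cas (window_graph S r) (window S r i)
     (map (window S (Suc r)) [i..<i + l]) (window S r (i + l))"
proof (induction l arbitrary: i)
  case 0
  then show ?case
    by (simp add: pre_digraph.cas.simps)
next
  case (Suc l)
  have "[i..<i + Suc l] = i # [Suc i..<Suc i + l]"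
    by (simp add: upt_conv_Cons)
  then show ?case
    using Suc[of "Suc i"] by (simp add: pre_digraph.cas.simps)
qed

text \<open>
  The walk along the windows at \<open>0, \<dots>, m - 1\<close> closes up because the windows at \<open>0\<close> and \<open>m\<close> agree, and
  the window property is what makes it a trail.
\<close>

lemma window_graph_euler_trail:
  assumes win: "window_seq k (Suc r) m S"
  shows "pre_digraph.euler_trail (window_graph S r) (window S r 0)
           (map (window S (Suc r)) [0..<m]) (window S r 0)"
proof -
  let ?G = "window_graph S r" and ?u = "window S r 0" and ?p = "map (window S (Suc r)) [0..<m]"
  have per: "periodic_seq k m S"
    using win by (rule window_seq_imp_periodic)
  interpret fin_digraph ?G
    using per by (rule fin_digraph_window_graph)
  have arcs: "set ?p = arcs ?G"
    using range_window[OF per] by simp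
  have "window S r m = ?u"
    using window_mod[OF per, of r m] by simp
  then have walk: "awalk ?u ?p ?u"
    using cas_windows[of S r 0 m] arcs by (simp add: awalk_def)
  have "inj_on (window S (Suc r)) {0..<m}"
    using win by (rule inj_on_window)
  then have "trail ?u ?p ?u"
    using walk by (simp add: trail_def distinct_map)
  moreover have "set (awalk_verts ?u ?p) = verts ?G"
  proof -
    have "set (awalk_verts ?u ?p) = {?u} \<union> butlast ` arcs ?G \<union> tl ` arcs ?G"
      using set_awalk_verts[OF walk] unfolding arcs[symmetric]
      by (simp only: set_map window_graph_simps)
    also have "\<dots> = verts ?G"
      by (auto simp: image_image)
    finally show ?thesis .
  qed
  ultimately show ?thesis
    using arcs by (simp add: euler_trail_def)
qed

lemma eulerian_window_graph:
  assumes "window_seq k (Suc r) m S"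
  shows "eulerian (window_graph S r)"
proof -
  interpret fin_digraph "window_graph S r"
    using window_seq_imp_periodic[OF assms] by (rule fin_digraph_window_graph)
  show ?thesis
    using closed_euler2[OF window_graph_euler_trail[OF assms]] by (simp add: eulerian_def)
qed

lemma card_arcs_window_graph:
  assumes win: "window_seq k (Suc r) m S"
  shows "card (arcs (window_graph S r)) = m"
proof -
  have "arcs (window_graph S r) = window S (Suc r) ` {0..<m}"
    using range_window[OF window_seq_imp_periodic[OF win]] by simp
  moreover have "inj_on (window S (Suc r)) {0..<m}"
    using win by (rule inj_on_window)
  ultimately show ?thesis
    by (simp add: card_image)
qed

lemma antisymmetric_window_graph_iff:
  assumes "1 \<le> r"
  shows "antisymmetric_graph (window_graph S r) \<longleftrightarrow>
           (\<forall>i j. window S (Suc r) i \<noteq> rev (window S (Suc r) j))"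
proof -
  have "antisymmetric_graph (window_graph S r) \<longleftrightarrow>
          (\<forall>a \<in> arcs (window_graph S r). rev a \<notin> arcs (window_graph S r))"
    by (rule antisymmetric_graph_iff_rev[where n = "Suc r"]) (use assms in auto)
  then show ?thesis
    unfolding window_graph_simps by (metis rangeE rangeI)
qed

section \<open>Sequences from Euler circuits\<close>

text \<open>
  Overlap pushes entry \<open>j\<close> of one list to entry \<open>j - 1\<close> of the next, so entry \<open>j\<close> of the list at \<open>i\<close>
  is the first entry of the list at \<open>i + j\<close>.
\<close>

lemma window_hd_of_overlapping:
  assumes len: "\<And>i. length (w i) = n"
    and overlap: "\<And>i. tl (w i) = butlast (w (Suc i))"
  shows "window (\<lambda>i. hd (w i)) n i = w i"
proof (rule nth_equalityI)
  fix j assume "j < length (window (\<lambda>i. hd (w i)) n i)"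
  then have j: "j < n"
    by simp
  then have "w i ! j = w (i + j) ! 0"
  proof (induction j arbitrary: i)
    case (Suc j)
    have "w i ! Suc j = tl (w i) ! j"
      using Suc.prems len[of i] by (simp add: nth_tl)
    also have "\<dots> = w (Suc i) ! j"
      using Suc.prems len[of "Suc i"] by (simp add: overlap nth_butlast)
    also have "\<dots> = w (i + Suc j) ! 0"
      using Suc by simp
    finally show ?case .
  qed simp
  moreover have "w (i + j) \<noteq> []"
    using len[of "i + j"] j by auto
  ultimately show "window (\<lambda>i. hd (w i)) n i ! j = w i ! j"
    using j by (simp add: hd_conv_nth)
qed (simp add: len)

text \<open>
  The vertex list of a closed walk can be read off the tails, with the start appended, or off the
  heads, with the start prepended; comparing the two position by position links each arc to the
  next.
\<close>

lemma (in wf_digraph) closed_awalk_cyclic_successor: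
  assumes walk: "awalk u p u" and "p \<noteq> []"
  shows "head G (p ! (i mod length p)) = tail G (p ! (Suc i mod length p))"
proof -
  let ?m = "length p" and ?j = "i mod length p"
  have j: "?j < ?m"
    using \<open>p \<noteq> []\<close> by simp
  have cas: "cas u p u"
    using walk by blast
  have verts: "map (tail G) p @ [u] = u # map (head G) p"
  proof -
    have "map (tail G) p @ [head G (last p)] = tail G (hd p) # map (head G) p"
      using awalk_verts_conv[of u p] awalk_verts_conv'[OF cas] \<open>p \<noteq> []\<close> by simp
    moreover have "tail G (hd p) = u"
      using awalk_verts_conv'[OF cas] awhd_if_cas[OF cas] \<open>p \<noteq> []\<close> by simp
    moreover have "head G (last p) = u"
      using awalk_verts_conv[of u p] awlast_if_cas[OF cas] \<open>p \<noteq> []\<close> by simp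
    ultimately show ?thesis
      by simp
  qed
  have head: "head G (p ! ?j) = (map (tail G) p @ [u]) ! Suc ?j"
    unfolding verts using j by simp
  show ?thesis
  proof (cases "Suc ?j < ?m")
    case True
    then have "Suc i mod ?m = Suc ?j"
      by (simp add: mod_Suc)
    with True head show ?thesis
      by (simp add: nth_append)
  next
    case False
    with j have "Suc ?j = ?m"
      by simp
    moreover from this have "Suc i mod ?m = 0"
      by (simp add: mod_Suc)
    moreover have "tail G (p ! 0) = u"
      using arg_cong[OF verts, of "\<lambda>xs. xs ! 0"] \<open>p \<noteq> []\<close> by (simp add: nth_append)
    ultimately show ?thesis
      using head by (simp add: nth_append)
  qed
qed

text \<open>
  Repeating an Euler circuit \<open>p\<close> periodically gives the sequence \<open>w\<close> of overlapping edges. An Euler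
  circuit with at least one edge visits only endpoints of edges, and the head of each edge is the
  tail of the next, so the vertices of \<open>T\<close> are just the tails of the \<open>w i\<close>, which are the windows of
  length \<open>r\<close>. With \<open>m = 0\<close> this would fail: a single vertex without edges is Eulerian too.
\<close>

lemma eulerian_subgraph_debruijn_is_window_graph:
  assumes sub: "subgraph T (debruijn k r)" and eul: "eulerian T"
    and card: "card (arcs T) = m" and "0 < m"
  obtains S where "window_seq k (Suc r) m S" "window_graph S r = T"
proof -
  have tail: "tail T = butlast" and head: "head T = tl"
    and arcs: "arcs T \<subseteq> tuples k (Suc r)" and verts: "verts T \<subseteq> tuples k r"
    using sub by (auto simp: subgraph_def compatible_def debruijn_def)
  have "finite (tuples k q)" for q
    using finite_lists_length_eq[of "{..<k}" q] by (simp add: tuples_def conj_commute)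
  then have "finite (arcs T)" "finite (verts T)"
    using arcs verts finite_subset by blast+
  then interpret fin_digraph T
    using sub by (auto simp: subgraph_def intro!: wf_digraph.fin_digraphI)
  obtain u p where euler: "euler_trail u p u"
    using eul closed_euler1 by (auto simp: eulerian_def)
  then have walk: "awalk u p u" and dist: "distinct p" and set_p: "set p = arcs T"
    and walk_verts: "set (awalk_verts u p) = verts T"
    by (simp_all add: euler_trail_def trail_def)
  have len_p: "length p = m"
    using dist set_p card distinct_card by fastforce
  with \<open>0 < m\<close> have "p \<noteq> []"
    by auto
  define w where "w i = p ! (i mod m)" for i
  define S where "S i = hd (w i)" for i
  have range_w: "range w = arcs T"
  proof (intro equalityI subsetI)
    fix e assume "e \<in> arcs T"
    then obtain j where "j < m" "e = p ! j"
      using set_p len_p by (metis in_set_conv_nth)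
    then show "e \<in> range w"
      by (intro range_eqI[of _ _ j]) (simp add: w_def)
  next
    fix e assume "e \<in> range w"
    then obtain i where "e = p ! (i mod m)"
      by (auto simp: w_def)
    then show "e \<in> arcs T"
      unfolding set_p[symmetric] using len_p \<open>0 < m\<close> by simp
  qed
  have w_arc: "w i \<in> tuples k (Suc r)" for i
    using range_w arcs by blast
  have overlap: "tl (w i) = butlast (w (Suc i))" for i
    using closed_awalk_cyclic_successor[OF walk \<open>p \<noteq> []\<close>, of i]
    by (simp add: w_def len_p tail head)
  have win: "window S (Suc r) i = w i" for i
    unfolding S_def using w_arc overlap
    by (intro window_hd_of_overlapping) (simp_all add: tuples_def)
  have "window_seq k (Suc r) m S"
    unfolding window_seq_def periodic_seq_def
  proof (intro conjI allI impI)
    fix i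
    have "w i \<noteq> []" "set (w i) \<subseteq> {..<k}"
      using w_arc[of i] by (auto simp: tuples_def)
    then show "S i < k"
      unfolding S_def using hd_in_set by blast
    show "S (i + m) = S i"
      by (simp add: S_def w_def)
  next
    fix i j assume "window S (Suc r) i = window S (Suc r) j"
    then have "p ! (i mod m) = p ! (j mod m)"
      by (simp add: win w_def)
    then show "[i = j] (mod m)"
      using dist len_p \<open>0 < m\<close> by (simp add: nth_eq_iff_index_eq cong_def)
  qed (fact \<open>0 < m\<close>)
  moreover have "window_graph S r = T"
  proof (rule pre_digraph.equality)
    show arcs_eq: "arcs (window_graph S r) = arcs T"
      using range_w by (simp add: win)
    have "verts T = butlast ` range w \<union> tl ` range w"
      using set_awalk_verts_not_Nil[OF walk \<open>p \<noteq> []\<close>] walk_verts set_p range_w tail head by simp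
    also have "\<dots> = range (\<lambda>i. butlast (w i))"
      by (auto simp: overlap)
    also have "\<dots> = verts (window_graph S r)"
      by (simp flip: win)
    finally show "verts (window_graph S r) = verts T" ..
  qed (simp_all add: tail head)
  ultimately show thesis
    by (rule that)
qed

section \<open>Orientable sequences and antisymmetric Eulerian subgraphs\<close>

theorem theorem3p5:
  fixes n k m :: nat
  assumes "2 \<le> n" and "2 \<le> k" and "1 \<le> m"
  shows "(\<forall>S. orientable_seq k n m S \<longrightarrow>
            subgraph (edge_graph k n m S) (debruijn k (n - 1)) \<and>
            antisymmetric_graph (edge_graph k n m S) \<and>
            eulerian (edge_graph k n m S) \<and>
            card (arcs (edge_graph k n m S)) = m) \<and>
         (\<forall>T. subgraph T (debruijn k (n - 1)) \<and> antisymmetric_graph T \<and> eulerian T \<and>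
            card (arcs T) = m \<longrightarrow>
            (\<exists>S. orientable_seq k n m S \<and> edge_graph k n m S = T))"
proof -
  obtain r where n: "n = Suc r" and r: "1 \<le> r"
    using \<open>2 \<le> n\<close> by (cases n) auto
  have orientable_iff: "orientable_seq k n m S \<longleftrightarrow>
      window_seq k (Suc r) m S \<and> antisymmetric_graph (window_graph S r)" for S
    using antisymmetric_window_graph_iff[OF r] by (simp add: orientable_seq_def n)
  have edge_graph: "edge_graph k n m S = window_graph S r" if "window_seq k (Suc r) m S" for S
    unfolding n using window_seq_imp_periodic[OF that] by (rule edge_graph_eq_window_graph)
  show ?thesis
  proof (intro conjI allI impI)
    fix S assume "orientable_seq k n m S"
    then have win: "window_seq k (Suc r) m S" and anti: "antisymmetric_graph (window_graph S r)"
      by (simp_all add: orientable_iff)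
    show "subgraph (edge_graph k n m S) (debruijn k (n - 1))"
      using subgraph_window_graph_debruijn[OF window_seq_imp_periodic[OF win], of r]
        edge_graph[OF win] by (simp add: n)
    show "antisymmetric_graph (edge_graph k n m S)"
      using anti edge_graph[OF win] by simp
    show "eulerian (edge_graph k n m S)"
      using eulerian_window_graph[OF win] edge_graph[OF win] by simp
    show "card (arcs (edge_graph k n m S)) = m"
      using card_arcs_window_graph[OF win] edge_graph[OF win] by simp
  next
    fix T
    assume T: "subgraph T (debruijn k (n - 1)) \<and> antisymmetric_graph T \<and> eulerian T \<and>
      card (arcs T) = m"
    then obtain S where "window_seq k (Suc r) m S" "window_graph S r = T"
      using eulerian_subgraph_debruijn_is_window_graph[of T k r m] \<open>1 \<le> m\<close> by (auto simp: n)
    with T show "\<exists>S. orientable_seq k n m S \<and> edge_graph k n m S = T"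
      using orientable_iff[of S] edge_graph[of S] by auto
  qed
qed

end
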